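(* Suppose the nonlinear program $\min_{x}\phi(x)$ subject to $c(x)=0$, $\ell\le x\le u$ has the structure $\phi(x)=f(t)$, $c(x)=\begin{bmatrix} c_{\mathcal E}(t)\\ c_{\mathcal I}(t)-s\end{bmatrix}$, $x=\begin{bmatrix} t\\ s\end{bmatrix}$, $\ell=\begin{bmatrix}\ell_t\\ \ell_s\end{bmatrix}$, $u=\begin{bmatrix}u_t\\ u_s\end{bmatrix}$ (that is, it is the slack reformulation of minimizing $f(t)$ subject to $c_{\mathcal E}(t)=0$, $\ell_s\le c_{\mathcal I}(t)\le u_s$, $\ell_t\le t\le u_t$). Then the linear system in $\Delta x=(\Delta t,\Delta s)$ $$ (\hat H+\delta_k I+\hat\rho_k J^\top J)\,\Delta x = J^\top (y_k-\hat\rho_k c)-\bigl(\nabla\phi(x)-(X-L)^{-1}\mu_k e+(U-X)^{-1}\mu_k e\bigr) $$ is equivalent to $$ \left(W_t+\Sigma_t+\hat\rho_k J_{c_{\mathcal E}}^\top J_{c_{\mathcal E}}+\hat\rho_k J_{c_{\mathcal I}}^\top\Omega_k J_{c_{\mathcal I}}\right)\Delta t = r_t+\hat\rho_k J_{c_{\mathcal I}}^\top r_s , $$ with $$ \begin{aligned} W_t&:=\nabla^2 f(t)-\sum_{i=1}^m y_i\nabla^2 h_i(t),\\ K_t&:=W_t+\hat\rho_k J_{c_{\mathcal E}}^\top J_{c_{\mathcal E}}+\hat\rho_k J_{c_{\mathcal I}}^\top J_{c_{\mathcal I}}+\Sigma_t,\\ \Omega_k&:=\Sigma_s(\hat\rho_k+\Sigma_s)^{-1},\\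 r_t&:=J_h^\top(y_k-\hat\rho_k c)-\nabla f(t)+(T-L_t)^{-1}\mu_k e-(U_t-T)^{-1}\mu_k e,\\ r_s&:=M^\top(y_k-\hat\rho_k c)+(S-L_s)^{-1}\mu_k e-(U_s-S)^{-1}\mu_k e . \end{aligned} $$
   Context: The functions $f$ (real-valued), $c_{\mathcal E}$ and $c_{\mathcal I}$ (vector-valued, with $m$ components in total) are twice continuously differentiable; $x=(t,s)\in\mathbb R^n$, where $s$ is a slack vector with as many entries as $c_{\mathcal I}$. The point $x$ is strictly interior: $\ell<x<u$ componentwise. The vector $y\in\mathbb R^m$ is the current multiplier of the equality constraints, $y_k\in\mathbb R^m$ is the augmented Lagrangian multiplier estimate, and $z_l=(z_{l,t},z_{l,s})\ge 0$, $z_u=(z_{u,t},z_{u,s})\ge 0$ in $\mathbb R^n$ are the bound multipliers. The scalars are the penalty parameter $\rho_k>0$, the inertia regularization $\delta_k\ge 0$, the barrier parameter $\mu_k>0$, and $\hat\rho_k:=\rho_k+\delta_k$. The vector $e$ is the all-ones vector of appropriate size. A scalar added to a matrix, as in $\hat\rho_k+\Sigma_s$, means that multiple of the identity. Capital letters denote diagonal matrices of the corresponding vectors: $X=\mathrm{diag}(x)$, $L=\mathrm{diag}(\ell)$, $U=\mathrm{diag}(u)$, $Z_l=\mathrm{diag}(z_l)$, $Z_u=\mathrm{diag}(z_u)$, $T=\mathrm{diag}(t)$, $S=\mathrm{diag}(s)$, $L_t=\mathrm{diag}(\ell_t)$, $U_t=\mathrm{diag}(u_t)$, $L_s=\mathrm{diag}(\ell_s)$,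 $U_s=\mathrm{diag}(u_s)$, and similarly $Z_{l,t},Z_{u,t},Z_{l,s},Z_{u,s}$. Here $c=c(x)$ and $J=J(x)$ is the $m\times n$ Jacobian of $c$ at $x$; $H=\nabla^2\phi(x)-\sum_{j=1}^m y_j\nabla^2 c_j(x)$ and $\hat H=H+\Sigma$ with $\Sigma=(X-L)^{-1}Z_l+(U-X)^{-1}Z_u$. Further, $h(t)=\begin{bmatrix}c_{\mathcal E}(t)^\top & c_{\mathcal I}(t)^\top\end{bmatrix}^\top$; $J_h$, $J_{c_{\mathcal E}}$, $J_{c_{\mathcal I}}$ are the Jacobians of $h$, $c_{\mathcal E}$, $c_{\mathcal I}$ at $t$; $M^\top=\begin{bmatrix}0&-I\end{bmatrix}$, with the zero block corresponding to the equality constraints and the identity block having the size of $s$; and $$\Sigma_t=(T-L_t)^{-1}Z_{l,t}+(U_t-T)^{-1}Z_{u,t},\qquad \Sigma_s=(S-L_s)^{-1}Z_{l,s}+(U_s-S)^{-1}Z_{u,s}.$$ The second system is the one obtained after eliminating the slack step via $\Delta s=(\Sigma_s+\hat\rho_k I)^{-1}(\hat\rho_k J_{c_{\mathcal I}}\Delta t+r_s)$.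
   Formalization: The right-hand side is corrected to r_t + ρ̂_k J_{c_I}^T (ρ̂_k+Σ_s)^{-1} r_s; for δ_k > 0, Σ_t and Σ_s are replaced by Σ_t+δ_k I and Σ_s+δ_k I in the reduced system, in Ω_k and in the Δs formula, since the printed system is false in both respects. *)

theory Defs
  imports "HOL-Analysis.Analysis"
begin

text \<open>Twice continuously Frechet differentiable on the whole space.\<close>

definition twice_cont_diff ::
    "('a::euclidean_space \<Rightarrow> 'b::real_normed_vector) \<Rightarrow> bool" where
  "twice_cont_diff f \<longleftrightarrow>
     (\<exists>(f' :: 'a \<Rightarrow> 'a \<Rightarrow>\<^sub>L 'b) (f'' :: 'a \<Rightarrow> 'a \<Rightarrow>\<^sub>L ('a \<Rightarrow>\<^sub>L 'b)).
        (\<forall>x. (f has_derivative blinfun_apply (f' x)) (at x)) \<and>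
        (\<forall>x. (f' has_derivative blinfun_apply (f'' x)) (at x)) \<and>
        continuous_on UNIV f'')"

definition gradient :: "(real ^ 'n::finite \<Rightarrow> real) \<Rightarrow> real ^ 'n \<Rightarrow> real ^ 'n" where
  "gradient f x = (\<chi> i. frechet_derivative f (at x) (axis i 1))"

definition hessian :: "(real ^ 'n::finite \<Rightarrow> real) \<Rightarrow> real ^ 'n \<Rightarrow> real ^ 'n ^ 'n" where
  "hessian f x = jacobian (gradient f) (at x)"

definition diag_mat :: "real ^ 'n::finite \<Rightarrow> real ^ 'n ^ 'n" where
  "diag_mat v = (\<chi> i j. if i = j then v $ i else 0)"

text \<open>Vertical concatenation of column vectors: the index set of the result is the disjoint
  union of the two index sets.\<close>

definition stack ::
    "real ^ 'a::finite \<Rightarrow> real ^ 'b::finite \<Rightarrow> real ^ ('a + 'b)" where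
  "stack a b = (\<chi> k. case k of Inl i \<Rightarrow> a $ i | Inr j \<Rightarrow> b $ j)"

definition upper_part :: "real ^ ('a::finite + 'b::finite) \<Rightarrow> real ^ 'a" where
  "upper_part v = (\<chi> i. v $ Inl i)"

definition lower_part :: "real ^ ('a::finite + 'b::finite) \<Rightarrow> real ^ 'b" where
  "lower_part v = (\<chi> j. v $ Inr j)"

text \<open>The matrix with upper block \<open>0\<close> and lower block \<open>-I\<close>, i.e. the Jacobian of the
  constraints with respect to the slacks; its transpose is \<open>[0  -I]\<close>.\<close>

definition slack_mat :: "real ^ 'i::finite ^ ('e::finite + 'i)" where
  "slack_mat = (\<chi> k j. case k of Inl _ \<Rightarrow> 0 | Inr i \<Rightarrow> if i = j then - 1 else 0)"

end

theory Submission
  imports Defs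
begin

text \<open>
  The slack \<open>s\<close> enters the program affinely: the objective does not see it, and the constraints
  are \<open>c(t, s) = h t + M s\<close> with the constant matrix \<open>M\<close>. Hence the Jacobian of \<open>c\<close> is
  \<open>[J\<^sub>h  M]\<close>, while every Hessian, of the objective and of each constraint, is the corresponding
  Hessian in \<open>t\<close> bordered by zeros (\<open>jacobian_add_linear_mult\<close>, \<open>hessian_add_linear_mult\<close>).
  The bound terms are diagonal, so they split along \<open>(t, s)\<close> as well. Since
  \<open>J\<^sub>h\<^sup>T J\<^sub>h = J\<^sub>E\<^sup>T J\<^sub>E + J\<^sub>I\<^sup>T J\<^sub>I\<close>, \<open>J\<^sub>h\<^sup>T M = - J\<^sub>I\<^sup>T\<close> and \<open>M\<^sup>T M = I\<close>, the full system reads, with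
  \<open>S = \<Sigma>\<^sub>s + \<delta> I\<close>,

    \<open>(W\<^sub>t + \<Sigma>\<^sub>t + \<delta> I + \<rho>' J\<^sub>E\<^sup>T J\<^sub>E) dt + \<rho>' J\<^sub>I\<^sup>T (J\<^sub>I dt - ds) = r\<^sub>t\<close>,
    \<open>S ds - \<rho>' (J\<^sub>I dt - ds) = r\<^sub>s\<close>.

  The matrix \<open>\<rho>' I + S\<close> is diagonal with positive entries, because \<open>\<rho>' > 0\<close> and, at a strictly
  interior point with nonnegative bound multipliers, \<open>\<Sigma>\<^sub>s \<ge> 0\<close>. So the second row determines
  \<open>ds = (\<rho>' I + S)\<^sup>-\<^sup>1 (\<rho>' J\<^sub>I dt + r\<^sub>s)\<close>. Substituting into the first row and using
  \<open>I - \<rho>' (\<rho>' I + S)\<^sup>-\<^sup>1 = S (\<rho>' I + S)\<^sup>-\<^sup>1\<close> gives the reduced system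
  (\<open>penalty_block_elimination\<close>). Both directions hold because the second row is equivalent to the
  formula for \<open>ds\<close>. The first of the two claimed equivalences is the case \<open>\<delta> = 0\<close> of the second.

  Block matrices are described throughout by their action on stacked vectors, and transposes by
  adjointness.
\<close>

section \<open>Stacked vectors\<close>

lemma stack_nth [simp]: "stack a b $ Inl i = a $ i" "stack a b $ Inr j = b $ j"
  by (simp_all add: stack_def)

lemma part_stack [simp]: "upper_part (stack a b) = a" "lower_part (stack a b) = b"
  by (simp_all add: upper_part_def lower_part_def vec_eq_iff)

lemma stack_parts [simp]: "stack (upper_part v) (lower_part v) = v"
  by (simp add: vec_eq_iff split_sum_all upper_part_def lower_part_def)

lemma stack_eq_iff: "stack a b = stack a' b' \<longleftrightarrow> a = a' \<and> b = b'"
  by (metis part_stack)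

lemma stack_arith:
  "stack a b + stack a' b' = stack (a + a') (b + b')"
  "stack a b - stack a' b' = stack (a - a') (b - b')"
  "r *\<^sub>R stack a b = stack (r *\<^sub>R a) (r *\<^sub>R b)"
  "stack 0 0 = 0"
  by (simp_all add: vec_eq_iff split_sum_all)

lemma inner_stack: "stack a b \<bullet> stack a' b' = a \<bullet> a' + b \<bullet> b'"
  by (simp add: inner_vec_def UNIV_Plus_UNIV[symmetric] sum.Plus del: UNIV_Plus_UNIV)

lemma bounded_linear_parts:
  "bounded_linear (upper_part :: real ^ ('a::finite + 'b::finite) \<Rightarrow> _)"
  "bounded_linear (lower_part :: real ^ ('a::finite + 'b::finite) \<Rightarrow> _)"
  by (simp_all add: linear_conv_bounded_linear[symmetric] linear_iff
      upper_part_def lower_part_def vec_eq_iff)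

lemma bounded_linear_stack:
  "bounded_linear (\<lambda>a. stack a 0 :: real ^ ('a::finite + 'b::finite))"
  "bounded_linear (\<lambda>b. stack 0 b :: real ^ ('a::finite + 'b::finite))"
  by (simp_all add: linear_conv_bounded_linear[symmetric] linear_iff stack_arith)

lemma sum_stack_zero: "(\<Sum>k\<in>K. stack (g k) 0) = stack (sum g K) 0"
  by (rule linear_sum[OF bounded_linear.linear[OF bounded_linear_stack(1)], symmetric])

lemma axis_parts [simp]:
  "upper_part (axis (Inl i) 1) = axis i 1" "lower_part (axis (Inl i) 1) = 0"
  "upper_part (axis (Inr j) 1) = 0" "lower_part (axis (Inr j) 1) = axis j 1"
  by (simp_all add: upper_part_def lower_part_def axis_def vec_eq_iff)

section \<open>Transposes of block matrices\<close>

lemma transpose_mult_eqI: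
  fixes B :: "real ^ 'n ^ 'm"
  assumes "\<And>v. w \<bullet> (B *v v) = z \<bullet> v"
  shows "transpose B *v w = z"
  by (metis assms dot_lmul_matrix transpose_matrix_vector vector_eq_rdot)

text \<open>\<open>J\<close> is the block row \<open>[B  M]\<close>, given by its action on stacked vectors. Since the inner product
  of stacked vectors is the sum over the blocks, its adjoint is a block column.\<close>

lemma transpose_block_row_mult:
  fixes J :: "real ^ ('a::finite + 'b::finite) ^ 'm::finite"
  assumes "\<And>a b. J *v stack a b = B *v a + M *v b"
  shows "transpose J *v w = stack (transpose B *v w) (transpose M *v w)"
proof (rule transpose_mult_eqI)
  fix v :: "real ^ ('a + 'b)"
  have "w \<bullet> (J *v v) = w \<bullet> (B *v upper_part v + M *v lower_part v)"
    by (metis assms stack_parts)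
  also have "\<dots> = stack (transpose B *v w) (transpose M *v w) \<bullet> stack (upper_part v) (lower_part v)"
    unfolding inner_stack by (simp add: inner_add_right dot_lmul_matrix)
  finally show "w \<bullet> (J *v v) = stack (transpose B *v w) (transpose M *v w) \<bullet> v" by simp
qed

text \<open>The dual situation: \<open>B\<close> is the block column with blocks \<open>P\<close> and \<open>Q\<close>.\<close>

lemma transpose_block_column_mult:
  assumes "\<And>a. B *v a = stack (P *v a) (Q *v a)"
  shows "transpose B *v stack p q = transpose P *v p + transpose Q *v q"
  by (rule transpose_mult_eqI)
    (simp add: assms inner_stack inner_add_left dot_lmul_matrix)

lemma slack_mat_mult: "slack_mat *v b = stack 0 (- b)"
  by (simp add: vec_eq_iff split_sum_all slack_mat_def matrix_vector_mult_def if_distrib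
      if_distribR cong: if_cong)

lemma transpose_slack_mat_mult: "transpose slack_mat *v stack p q = - q"
  by (rule transpose_mult_eqI) (simp add: slack_mat_mult inner_stack)

lemma sum_matrix_mult_vec:
  "(\<Sum>j\<in>S. y j *\<^sub>R (B j :: real ^ 'n ^ 'm)) *v a = (\<Sum>j\<in>S. y j *\<^sub>R (B j *v a))"
  by (induction S rule: infinite_finite_induct)
    (simp_all add: matrix_vector_mult_add_rdistrib scaleR_matrix_vector_assoc)

section \<open>Diagonal matrices and inverses\<close>

lemma diag_mat_mult_vec: "diag_mat v *v a = (\<chi> i. v $ i * a $ i)"
  by (simp add: vec_eq_iff diag_mat_def matrix_vector_mult_def mult_delta_left)

lemma diag_mat_arith:
  "diag_mat v + diag_mat w = diag_mat (v + w)" "diag_mat v - diag_mat w = diag_mat (v - w)"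
  "mat r = diag_mat (vec r)" "diag_mat v ** diag_mat w = diag_mat (v * w)"
  by (simp_all add: vec_eq_iff diag_mat_def mat_def matrix_matrix_mult_def mult_delta_left)

lemma mat_mult_vec: "mat r *v w = r *\<^sub>R (w :: real ^ 'n::finite)"
  by (simp add: diag_mat_arith diag_mat_mult_vec vec_eq_iff)

lemma matrix_inv_works:
  assumes "invertible A"
  shows "A ** matrix_inv A = mat 1" "matrix_inv A ** A = mat 1"
  using someI_ex[OF assms[unfolded invertible_def]] unfolding matrix_inv_def by blast+

lemma matrix_inv_eqI:
  assumes "A ** B = mat 1" "B ** A = mat 1"
  shows "matrix_inv A = B"
proof -
  have "invertible A" using assms unfolding invertible_def by blast
  then show ?thesis
    by (metis assms(2) matrix_inv_works(1) matrix_mul_assoc matrix_mul_lid matrix_mul_rid)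
qed

lemma diag_mat_inverse:
  assumes "\<forall>i. v $ i \<noteq> 0"
  shows "invertible (diag_mat v)" "matrix_inv (diag_mat v) = diag_mat (\<chi> i. inverse (v $ i))"
proof -
  have "diag_mat v ** diag_mat (\<chi> i. inverse (v $ i)) = mat 1"
    "diag_mat (\<chi> i. inverse (v $ i)) ** diag_mat v = mat 1"
    unfolding diag_mat_arith using assms by (simp_all add: vec_eq_iff diag_mat_def mat_def)
  then show "invertible (diag_mat v)" "matrix_inv (diag_mat v) = diag_mat (\<chi> i. inverse (v $ i))"
    unfolding invertible_def by (blast, rule matrix_inv_eqI)
qed

lemma diag_mat_stack_mult:
  "diag_mat (stack v w) *v stack a b = stack (diag_mat v *v a) (diag_mat w *v b)"
  by (simp add: diag_mat_mult_vec vec_eq_iff split_sum_all)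

lemma diag_mat_inverse_stack_mult:
  assumes "\<forall>k. stack v w $ k \<noteq> 0"
  shows "matrix_inv (diag_mat (stack v w)) *v stack a b
    = stack (matrix_inv (diag_mat v) *v a) (matrix_inv (diag_mat w) *v b)"
  using assms by (simp add: split_sum_all diag_mat_inverse diag_mat_mult_vec vec_eq_iff)

section \<open>Derivatives\<close>

lemma jacobian_mult_vec:
  fixes g :: "real ^ 'n::finite \<Rightarrow> real ^ 'm::finite"
  assumes "(g has_derivative g') (at v)"
  shows "jacobian g (at v) *v d = g' d"
proof -
  have "matrix g' *v d = g' d"
    by (rule matrix_works)
      (use assms has_derivative_linear in \<open>auto simp: linear_matrix_vector_mul_eq\<close>)
  then show ?thesis using frechet_derivative_at[OF assms] by (simp add: jacobian_def)
qed

lemma gradient_eq: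
  assumes "(g has_derivative g') (at v)"
  shows "gradient g v = (\<chi> i. g' (axis i 1))"
  using frechet_derivative_at[OF assms] by (simp add: gradient_def)

text \<open>With \<open>L\<close> the identity or a coordinate, this makes Hessians meaningful for the objective and
  for the individual constraints. The partial derivatives of \<open>L \<circ> g\<close> are
  \<open>v \<mapsto> L (g' v (axis i 1))\<close>, a bounded linear functional of the differentiable map \<open>g'\<close>.\<close>

lemma twice_cont_diff_linear_image:
  fixes g :: "real ^ 'n::finite \<Rightarrow> 'b::real_normed_vector"
  assumes g: "twice_cont_diff g" and L: "bounded_linear (L :: 'b \<Rightarrow> real)"
  shows "(\<lambda>v. L (g v)) differentiable at v" "gradient (\<lambda>v. L (g v)) differentiable at v"
proof -
  obtain g' g'' where g': "\<And>v. (g has_derivative blinfun_apply (g' v)) (at v)"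
    and g'': "\<And>v. (g' has_derivative blinfun_apply (g'' v)) (at v)"
    using g unfolding twice_cont_diff_def by blast
  have D: "((\<lambda>v. L (g v)) has_derivative (\<lambda>d. L (g' v d))) (at v)" for v
    using bounded_linear.has_derivative[OF L g'] .
  then show "(\<lambda>v. L (g v)) differentiable at v" unfolding differentiable_def by blast
  have E: "gradient (\<lambda>v. L (g v)) = (\<lambda>v. \<chi> i. L (g' v (axis i 1)))"
    by (rule ext) (rule gradient_eq[OF D])
  have "((\<lambda>v. L (g' v (axis i 1))) has_derivative (\<lambda>d. L (g'' v d (axis i 1)))) (at v)" for i
    using bounded_linear.has_derivative[OF bounded_linear_compose[OF L blinfun.bounded_linear_left] g'']
    by simp
  then have "((\<lambda>v. \<chi> i. L (g' v (axis i 1))) has_derivative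
      (\<lambda>d. \<chi> i. L (g'' v d (axis i 1)))) (at v)"
    by (subst has_derivative_componentwise_within) (auto simp: Basis_vec_def inner_axis)
  then show "gradient (\<lambda>v. L (g v)) differentiable at v" unfolding E differentiable_def by blast
qed

lemma has_derivative_stack:
  assumes "(p has_derivative p') F" and "(q has_derivative q') F"
  shows "((\<lambda>v. stack (p v) (q v)) has_derivative (\<lambda>d. stack (p' d) (q' d))) F"
proof -
  have "((\<lambda>v. stack (p v) 0 + stack 0 (q v)) has_derivative
      (\<lambda>d. stack (p' d) 0 + stack 0 (q' d))) F"
    by (intro has_derivative_add bounded_linear.has_derivative[OF bounded_linear_stack(1) assms(1)]
        bounded_linear.has_derivative[OF bounded_linear_stack(2) assms(2)])
  then show ?thesis by (simp add: stack_arith)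
qed

lemma jacobian_stack_mult:
  assumes "p differentiable at v" and "q differentiable at v"
  shows "jacobian (\<lambda>v. stack (p v) (q v)) (at v) *v d
    = stack (jacobian p (at v) *v d) (jacobian q (at v) *v d)"
proof -
  obtain p' q' where pq: "(p has_derivative p') (at v)" "(q has_derivative q') (at v)"
    using assms unfolding differentiable_def by blast
  show ?thesis
    by (simp add: jacobian_mult_vec[OF has_derivative_stack[OF pq]] pq[THEN jacobian_mult_vec])
qed

text \<open>The next three lemmas differentiate functions of \<open>(t, s)\<close> that are affine in \<open>s\<close> with a
  constant coefficient; this is the form of the objective and of the constraints of a program with
  slack variables.\<close>

lemma jacobian_add_linear_mult:
  assumes "h differentiable at (upper_part v)"
  shows "jacobian (\<lambda>v. h (upper_part v) + M *v lower_part v) (at v) *v stack a b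
    = jacobian h (at (upper_part v)) *v a + M *v b"
proof -
  obtain h' where h': "(h has_derivative h') (at (upper_part v))"
    using assms unfolding differentiable_def by blast
  have "((\<lambda>v. h (upper_part v) + M *v lower_part v) has_derivative
      (\<lambda>d. h' (upper_part d) + M *v lower_part d)) (at v)"
    by (intro has_derivative_add
        bounded_linear.has_derivative[OF matrix_vector_mul_bounded_linear]
        bounded_linear_imp_has_derivative[OF bounded_linear_parts(2)]
        has_derivative_compose[OF bounded_linear_imp_has_derivative[OF bounded_linear_parts(1)] h'])
  then show ?thesis by (simp add: jacobian_mult_vec[OF h'] jacobian_mult_vec)
qed

lemma gradient_add_linear:
  assumes f: "f differentiable at (upper_part v)"
  shows "gradient (\<lambda>v. f (upper_part v) + w \<bullet> lower_part v) v
    = stack (gradient f (upper_part v)) w"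
proof -
  let ?f' = "frechet_derivative f (at (upper_part v))"
  have f': "(f has_derivative ?f') (at (upper_part v))"
    using f frechet_derivative_works by blast
  have "((\<lambda>v. f (upper_part v) + w \<bullet> lower_part v) has_derivative
      (\<lambda>d. ?f' (upper_part d) + w \<bullet> lower_part d)) (at v)"
    by (intro has_derivative_add has_derivative_inner_right
        bounded_linear_imp_has_derivative[OF bounded_linear_parts(2)]
        has_derivative_compose[OF bounded_linear_imp_has_derivative[OF bounded_linear_parts(1)] f'])
  from gradient_eq[OF this] show ?thesis
    using has_derivative_linear[OF f', THEN linear_0]
    by (simp add: vec_eq_iff split_sum_all gradient_def inner_axis)
qed

text \<open>The lower block of the gradient is the constant \<open>w\<close> and its upper block is a function of \<open>t\<close>
  alone, so all second derivatives involving \<open>s\<close> vanish. The formula for the gradient is itself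
  differentiated, which is why \<open>f\<close> is assumed differentiable at more than one point.\<close>

lemma hessian_add_linear_mult:
  assumes f: "\<And>v. f differentiable at v" and grad: "gradient f differentiable at (upper_part v)"
  shows "hessian (\<lambda>v. f (upper_part v) + w \<bullet> lower_part v) v *v stack a b
    = stack (hessian f (upper_part v) *v a) 0"
proof -
  let ?g = "gradient f" and ?g' = "frechet_derivative (gradient f) (at (upper_part v))"
  have g': "(?g has_derivative ?g') (at (upper_part v))"
    using grad frechet_derivative_works by blast
  have E: "gradient (\<lambda>v. f (upper_part v) + w \<bullet> lower_part v)
      = (\<lambda>v. stack (?g (upper_part v)) 0 + stack 0 w)"
    by (rule ext) (simp add: gradient_add_linear f stack_arith)
  have "((\<lambda>v. stack (?g (upper_part v)) 0 + stack 0 w) has_derivative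
      (\<lambda>d. stack (?g' (upper_part d)) 0)) (at v)"
    by (intro has_derivative_add_const bounded_linear.has_derivative[OF bounded_linear_stack(1)]
        has_derivative_compose[OF bounded_linear_imp_has_derivative[OF bounded_linear_parts(1)] g'])
  then show ?thesis
    using jacobian_mult_vec[OF g'] by (simp add: hessian_def E jacobian_mult_vec)
qed

section \<open>Block elimination\<close>

text \<open>The second row is \<open>(r I + S) b = r B a + q\<close>, hence solvable for \<open>b\<close>. With
  \<open>D = (r I + S)\<^sup>-\<^sup>1\<close> one has \<open>S D = I - r D\<close>, so that \<open>B a - b = S D B a - D q\<close>: the term
  \<open>r C (B a - b)\<close> of the first row turns into \<open>r C S D B a\<close> and a shift of the right-hand side.\<close>

lemma penalty_block_elimination:
  fixes K :: "real ^ 't ^ 't" and B :: "real ^ 't ^ 'i" and C :: "real ^ 'i ^ 't"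
    and S :: "real ^ 'i ^ 'i"
  assumes inv: "invertible (mat r + S)"
  defines "D \<equiv> matrix_inv (mat r + S)"
  shows "K *v a + r *\<^sub>R (C *v (B *v a - b)) = p \<and> S *v b - r *\<^sub>R (B *v a - b) = q
    \<longleftrightarrow> (K + r *\<^sub>R (C ** (S ** D) ** B)) *v a = p + r *\<^sub>R (C *v (D *v q))
      \<and> b = D *v (r *\<^sub>R (B *v a) + q)"
proof -
  have D: "(mat r + S) ** D = mat 1" "D ** (mat r + S) = mat 1"
    using inv unfolding D_def by (simp_all add: matrix_inv_works)
  have second_row: "S *v b - r *\<^sub>R (B *v a - b) = q \<longleftrightarrow> b = D *v (r *\<^sub>R (B *v a) + q)"
  proof -
    have "S *v b - r *\<^sub>R (B *v a - b) = q \<longleftrightarrow> (mat r + S) *v b = r *\<^sub>R (B *v a) + q"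
      by (auto simp: matrix_vector_mult_add_rdistrib mat_mult_vec algebra_simps)
    also have "\<dots> \<longleftrightarrow> b = D *v (r *\<^sub>R (B *v a) + q)"
    proof
      assume "(mat r + S) *v b = r *\<^sub>R (B *v a) + q"
      from arg_cong[OF this, of "(*v) D"] show "b = D *v (r *\<^sub>R (B *v a) + q)"
        by (simp only: matrix_vector_mul_assoc D matrix_vector_mul_lid)
    qed (simp only: matrix_vector_mul_assoc D matrix_vector_mul_lid)
    finally show ?thesis .
  qed
  have SD: "S *v (D *v w) = w - r *\<^sub>R (D *v w)" for w
  proof -
    have "(mat r + S) *v (D *v w) = w" by (simp add: matrix_vector_mul_assoc D)
    then show ?thesis by (simp add: matrix_vector_mult_add_rdistrib mat_mult_vec algebra_simps)
  qed
  have "K *v a + r *\<^sub>R (C *v (B *v a - b)) = p \<longleftrightarrow>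
      (K + r *\<^sub>R (C ** (S ** D) ** B)) *v a = p + r *\<^sub>R (C *v (D *v q))"
    if b: "b = D *v (r *\<^sub>R (B *v a) + q)"
  proof -
    have "B *v a - b = S *v (D *v (B *v a)) - D *v q"
      unfolding b SD by (simp add: matrix_vector_right_distrib matrix_vector_mult_scaleR)
    then have "C *v (B *v a - b) = (C ** (S ** D) ** B) *v a - C *v (D *v q)"
      by (simp add: matrix_vector_mult_diff_distrib matrix_vector_mul_assoc[symmetric])
    then show ?thesis
      by (simp add: matrix_vector_mult_add_rdistrib scaleR_matrix_vector_assoc[symmetric]
          scaleR_diff_right add_diff_eq diff_eq_eq)
  qed
  with second_row show ?thesis by blast
qed

section \<open>Eliminating the slack step\<close>

theorem proposition3p1:
  fixes f :: "real ^ 't \<Rightarrow> real"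
    and c\<^sub>E :: "real ^ 't \<Rightarrow> real ^ 'e"
    and c\<^sub>I :: "real ^ 't \<Rightarrow> real ^ 'i"
    and \<phi> :: "real ^ ('t + 'i) \<Rightarrow> real"
    and c :: "real ^ ('t + 'i) \<Rightarrow> real ^ ('e + 'i)"
    and h :: "real ^ 't \<Rightarrow> real ^ ('e + 'i)"
    and t l\<^sub>t u\<^sub>t zl\<^sub>t zu\<^sub>t r\<^sub>t :: "real ^ 't"
    and s l\<^sub>s u\<^sub>s zl\<^sub>s zu\<^sub>s r\<^sub>s :: "real ^ 'i"
    and x l u zl zu b :: "real ^ ('t + 'i)"
    and y y\<^sub>k :: "real ^ ('e + 'i)"
    and \<rho> \<delta> \<mu> \<rho>' :: real
    and J :: "real ^ ('t + 'i) ^ ('e + 'i)"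
    and H \<Sigma> H' A :: "real ^ ('t + 'i) ^ ('t + 'i)"
    and J\<^sub>h :: "real ^ 't ^ ('e + 'i)"
    and J\<^sub>E :: "real ^ 't ^ 'e"
    and J\<^sub>I :: "real ^ 't ^ 'i"
    and W\<^sub>t \<Sigma>\<^sub>t K\<^sub>t :: "real ^ 't ^ 't"
    and \<Sigma>\<^sub>s \<Omega> :: "real ^ 'i ^ 'i"
    and M :: "real ^ 'i ^ ('e + 'i)"
  assumes smooth: "twice_cont_diff f" "twice_cont_diff c\<^sub>E" "twice_cont_diff c\<^sub>I"
    (* structure of the nonlinear program *)
    and phi: "\<phi> = (\<lambda>v. f (upper_part v))"
    and c: "c = (\<lambda>v. stack (c\<^sub>E (upper_part v)) (c\<^sub>I (upper_part v) - lower_part v))"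
    and x: "x = stack t s" and l: "l = stack l\<^sub>t l\<^sub>s" and u: "u = stack u\<^sub>t u\<^sub>s"
    and zl: "zl = stack zl\<^sub>t zl\<^sub>s" and zu: "zu = stack zu\<^sub>t zu\<^sub>s"
    and interior: "\<forall>k. l $ k < x $ k \<and> x $ k < u $ k"
    and zl_nonneg: "\<forall>k. 0 \<le> zl $ k" and zu_nonneg: "\<forall>k. 0 \<le> zu $ k"
    and scalars: "\<rho> > 0" "\<delta> \<ge> 0" "\<mu> > 0" "\<rho>' = \<rho> + \<delta>"
    (* the system in (dt, ds): A dx = b *)
    and J: "J = jacobian c (at x)"
    and H: "H = hessian \<phi> x - (\<Sum>j\<in>UNIV. y $ j *\<^sub>R hessian (\<lambda>v. c v $ j) x)"
    and Sigma: "\<Sigma> = matrix_inv (diag_mat x - diag_mat l) ** diag_mat zl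
                   + matrix_inv (diag_mat u - diag_mat x) ** diag_mat zu"
    and H': "H' = H + \<Sigma>"
    and A: "A = H' + mat \<delta> + \<rho>' *\<^sub>R (transpose J ** J)"
    and b: "b = transpose J *v (y\<^sub>k - \<rho>' *\<^sub>R c x)
                - (gradient \<phi> x - matrix_inv (diag_mat x - diag_mat l) *v (\<mu> *\<^sub>R vec 1)
                                + matrix_inv (diag_mat u - diag_mat x) *v (\<mu> *\<^sub>R vec 1))"
    (* the data of the reduced system *)
    and h: "h = (\<lambda>v. stack (c\<^sub>E v) (c\<^sub>I v))"
    and J_h: "J\<^sub>h = jacobian h (at t)"
    and J_E: "J\<^sub>E = jacobian c\<^sub>E (at t)"
    and J_I: "J\<^sub>I = jacobian c\<^sub>I (at t)"
    and M: "M = slack_mat"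
    and Sigma_t: "\<Sigma>\<^sub>t = matrix_inv (diag_mat t - diag_mat l\<^sub>t) ** diag_mat zl\<^sub>t
                     + matrix_inv (diag_mat u\<^sub>t - diag_mat t) ** diag_mat zu\<^sub>t"
    and Sigma_s: "\<Sigma>\<^sub>s = matrix_inv (diag_mat s - diag_mat l\<^sub>s) ** diag_mat zl\<^sub>s
                     + matrix_inv (diag_mat u\<^sub>s - diag_mat s) ** diag_mat zu\<^sub>s"
    and W_t: "W\<^sub>t = hessian f t - (\<Sum>i\<in>UNIV. y $ i *\<^sub>R hessian (\<lambda>v. h v $ i) t)"
    and K_t: "K\<^sub>t = W\<^sub>t + \<rho>' *\<^sub>R (transpose J\<^sub>E ** J\<^sub>E)
                   + \<rho>' *\<^sub>R (transpose J\<^sub>I ** J\<^sub>I) + \<Sigma>\<^sub>t"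
    and Omega: "\<Omega> = \<Sigma>\<^sub>s ** matrix_inv (mat \<rho>' + \<Sigma>\<^sub>s)"
    and r_t: "r\<^sub>t = transpose J\<^sub>h *v (y\<^sub>k - \<rho>' *\<^sub>R c x) - gradient f t
                 + matrix_inv (diag_mat t - diag_mat l\<^sub>t) *v (\<mu> *\<^sub>R vec 1)
                 - matrix_inv (diag_mat u\<^sub>t - diag_mat t) *v (\<mu> *\<^sub>R vec 1)"
    and r_s: "r\<^sub>s = transpose M *v (y\<^sub>k - \<rho>' *\<^sub>R c x)
                 + matrix_inv (diag_mat s - diag_mat l\<^sub>s) *v (\<mu> *\<^sub>R vec 1)
                 - matrix_inv (diag_mat u\<^sub>s - diag_mat s) *v (\<mu> *\<^sub>R vec 1)"
  shows
    "invertible (mat \<rho>' + \<Sigma>\<^sub>s) \<and> invertible (mat \<rho>' + (\<Sigma>\<^sub>s + mat \<delta>)) \<and>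
     (\<delta> = 0 \<longrightarrow>
       (\<forall>dt ds. A *v stack dt ds = b \<longleftrightarrow>
          (W\<^sub>t + \<Sigma>\<^sub>t + \<rho>' *\<^sub>R (transpose J\<^sub>E ** J\<^sub>E)
             + \<rho>' *\<^sub>R (transpose J\<^sub>I ** \<Omega> ** J\<^sub>I)) *v dt
            = r\<^sub>t + \<rho>' *\<^sub>R (transpose J\<^sub>I *v (matrix_inv (mat \<rho>' + \<Sigma>\<^sub>s) *v r\<^sub>s)) \<and>
          ds = matrix_inv (\<Sigma>\<^sub>s + mat \<rho>') *v (\<rho>' *\<^sub>R (J\<^sub>I *v dt) + r\<^sub>s))) \<and>
     (\<forall>dt ds. A *v stack dt ds = b \<longleftrightarrow>
        (W\<^sub>t + (\<Sigma>\<^sub>t + mat \<delta>) + \<rho>' *\<^sub>R (transpose J\<^sub>E ** J\<^sub>E)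
           + \<rho>' *\<^sub>R (transpose J\<^sub>I
                ** ((\<Sigma>\<^sub>s + mat \<delta>) ** matrix_inv (mat \<rho>' + (\<Sigma>\<^sub>s + mat \<delta>))) ** J\<^sub>I)) *v dt
          = r\<^sub>t + \<rho>' *\<^sub>R (transpose J\<^sub>I *v (matrix_inv (mat \<rho>' + (\<Sigma>\<^sub>s + mat \<delta>)) *v r\<^sub>s)) \<and>
        ds = matrix_inv ((\<Sigma>\<^sub>s + mat \<delta>) + mat \<rho>') *v (\<rho>' *\<^sub>R (J\<^sub>I *v dt) + r\<^sub>s))"
proof -
  have gap: "\<forall>k. stack (t - l\<^sub>t) (s - l\<^sub>s) $ k > 0" "\<forall>k. stack (u\<^sub>t - t) (u\<^sub>s - s) $ k > 0"
    using interior by (auto simp: x l u split_sum_all)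
  then have nz: "\<forall>k. stack (t - l\<^sub>t) (s - l\<^sub>s) $ k \<noteq> 0" "\<forall>k. stack (u\<^sub>t - t) (u\<^sub>s - s) $ k \<noteq> 0"
    by (metis less_irrefl)+

  have Sig_s: "\<Sigma>\<^sub>s = diag_mat (\<chi> i. zl\<^sub>s $ i / (s $ i - l\<^sub>s $ i) + zu\<^sub>s $ i / (u\<^sub>s $ i - s $ i))"
    using nz unfolding Sigma_s
    by (simp add: diag_mat_arith diag_mat_inverse split_sum_all)
      (simp add: diag_mat_def vec_eq_iff field_simps)
  have Sig_s_nonneg: "zl\<^sub>s $ i / (s $ i - l\<^sub>s $ i) + zu\<^sub>s $ i / (u\<^sub>s $ i - s $ i) \<ge> 0" for i
    using gap zl_nonneg zu_nonneg
    by (intro add_nonneg_nonneg divide_nonneg_pos) (simp_all add: split_sum_all zl zu)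
  have rho: "\<rho>' > 0" using scalars by simp
  have inv: "invertible (mat \<rho>' + (\<Sigma>\<^sub>s + mat d))" if "d \<ge> 0" for d
  proof -
    have "\<forall>i. 0 < \<rho>' + (zl\<^sub>s $ i / (s $ i - l\<^sub>s $ i) + zu\<^sub>s $ i / (u\<^sub>s $ i - s $ i) + d)"
      using rho that Sig_s_nonneg by (metis add_nonneg_nonneg add_pos_nonneg)
    then show ?thesis
      unfolding Sig_s diag_mat_arith
      by (intro diag_mat_inverse(1)) (simp add: less_imp_neq[symmetric])
  qed

  have Sig_stack: "\<Sigma> *v stack a b = stack (\<Sigma>\<^sub>t *v a) (\<Sigma>\<^sub>s *v b)" for a b
    using nz unfolding Sigma Sigma_t Sigma_s x l u zl zu
    by (simp add: diag_mat_arith stack_arith matrix_vector_mult_add_rdistrib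
        matrix_vector_mul_assoc[symmetric] diag_mat_stack_mult diag_mat_inverse_stack_mult)

  have dE: "c\<^sub>E differentiable at v" and dI: "c\<^sub>I differentiable at v" for v
    using smooth unfolding twice_cont_diff_def differentiable_def by blast+
  have dh: "h differentiable at v" for v
    using dE dI has_derivative_stack unfolding h differentiable_def by blast
  have c_h: "c = (\<lambda>v. h (upper_part v) + M *v lower_part v)"
    unfolding c h M by (simp add: slack_mat_mult stack_arith)
  have J_stack: "J *v stack a b = J\<^sub>h *v a + M *v b" for a b
    unfolding J c_h J_h by (simp add: jacobian_add_linear_mult dh x)
  have J_h_stack: "J\<^sub>h *v a = stack (J\<^sub>E *v a) (J\<^sub>I *v a)" for a
    unfolding J_h h J_E J_I by (rule jacobian_stack_mult[OF dE dI])
  note J_trans = transpose_block_row_mult[OF J_stack]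
  note J_h_trans = transpose_block_column_mult[OF J_h_stack]

  have f_diff: "f differentiable at v" "gradient f differentiable at v" for v
    using twice_cont_diff_linear_image[OF smooth(1) bounded_linear_ident] by simp_all
  have h_diff: "(\<lambda>v. h v $ k) differentiable at v" "gradient (\<lambda>v. h v $ k) differentiable at v"
    for k v
    using twice_cont_diff_linear_image[OF smooth(2) bounded_linear_vec_nth]
      twice_cont_diff_linear_image[OF smooth(3) bounded_linear_vec_nth]
    by (cases k; simp add: h)+
  \<comment> \<open>The zero coefficient of the slack brings the objective into the common affine form.\<close>
  have phi_affine: "\<phi> = (\<lambda>v. f (upper_part v) + 0 \<bullet> lower_part v)" by (simp add: phi)
  have grad_phi: "gradient \<phi> x = stack (gradient f t) 0"
    using f_diff unfolding phi_affine by (simp add: gradient_add_linear x del: inner_zero_left)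
  have hess_phi: "hessian \<phi> x *v stack a b = stack (hessian f t *v a) 0" for a b
    using f_diff unfolding phi_affine by (simp add: hessian_add_linear_mult x del: inner_zero_left)
  have hess_c: "hessian (\<lambda>v. c v $ k) x *v stack a b = stack (hessian (\<lambda>v. h v $ k) t *v a) 0"
    for k a b
  proof -
    have "(\<lambda>v. c v $ k) = (\<lambda>v. h (upper_part v) $ k + M $ k \<bullet> lower_part v)"
      by (simp add: c_h matrix_vector_mul_component)
    then show ?thesis
      using hessian_add_linear_mult[of "\<lambda>v. h v $ k" x "M $ k" a b] h_diff by (simp add: x)
  qed
  have H_stack: "H *v stack a b = stack (W\<^sub>t *v a) 0" for a b
    unfolding H W_t
    by (simp add: matrix_vector_mult_diff_rdistrib sum_matrix_mult_vec hess_phi hess_c stack_arith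
        sum_stack_zero)

  have JTJ: "transpose J *v (J *v stack a b) =
      stack (transpose J\<^sub>E *v (J\<^sub>E *v a) + transpose J\<^sub>I *v (J\<^sub>I *v a - b)) (- (J\<^sub>I *v a - b))" for a b
  proof -
    have "J *v stack a b = stack (J\<^sub>E *v a) (J\<^sub>I *v a - b)"
      unfolding J_stack J_h_stack M slack_mat_mult stack_arith by simp
    then show ?thesis
      unfolding J_trans by (simp only: J_h_trans M transpose_slack_mat_mult)
  qed
  have A_stack: "A *v stack a b =
      stack ((W\<^sub>t + (\<Sigma>\<^sub>t + mat \<delta>) + \<rho>' *\<^sub>R (transpose J\<^sub>E ** J\<^sub>E)) *v a
              + \<rho>' *\<^sub>R (transpose J\<^sub>I *v (J\<^sub>I *v a - b)))
            ((\<Sigma>\<^sub>s + mat \<delta>) *v b - \<rho>' *\<^sub>R (J\<^sub>I *v a - b))" for a b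
    unfolding A H' matrix_vector_mult_add_rdistrib scaleR_matrix_vector_assoc[symmetric]
      matrix_vector_mul_assoc[symmetric] JTJ H_stack Sig_stack mat_mult_vec stack_arith stack_eq_iff
    by (simp only: scaleR_add_right scaleR_minus_right) (simp add: algebra_simps)
  have b_stack: "b = stack r\<^sub>t r\<^sub>s"
  proof -
    have one: "\<mu> *\<^sub>R vec 1 = stack (\<mu> *\<^sub>R vec 1) (\<mu> *\<^sub>R vec 1)"
      by (simp add: vec_eq_iff split_sum_all)
    show ?thesis
      unfolding b r_t r_s J_trans grad_phi one unfolding x l u
      using nz by (simp add: diag_mat_arith stack_arith diag_mat_inverse_stack_mult stack_eq_iff)
  qed
  have reduced: "A *v stack dt ds = b \<longleftrightarrow>
        (W\<^sub>t + (\<Sigma>\<^sub>t + mat \<delta>) + \<rho>' *\<^sub>R (transpose J\<^sub>E ** J\<^sub>E)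
           + \<rho>' *\<^sub>R (transpose J\<^sub>I
                ** ((\<Sigma>\<^sub>s + mat \<delta>) ** matrix_inv (mat \<rho>' + (\<Sigma>\<^sub>s + mat \<delta>))) ** J\<^sub>I)) *v dt
          = r\<^sub>t + \<rho>' *\<^sub>R (transpose J\<^sub>I *v (matrix_inv (mat \<rho>' + (\<Sigma>\<^sub>s + mat \<delta>)) *v r\<^sub>s)) \<and>
        ds = matrix_inv ((\<Sigma>\<^sub>s + mat \<delta>) + mat \<rho>') *v (\<rho>' *\<^sub>R (J\<^sub>I *v dt) + r\<^sub>s)" for dt ds
    unfolding A_stack b_stack stack_eq_iff penalty_block_elimination[OF inv[OF scalars(2)]]
    by (simp add: add.commute[of _ "mat \<rho>'"])
  show ?thesis
    using inv[of 0] inv[OF scalars(2)] reduced unfolding Omega by simp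
qed

end
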